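(* Let $(f_\nu)_{\nu\in\mathcal I}$ be a parametric density family satisfying the standing assumption of the context, with associated probability measures $(P_\nu)_{\nu\in\mathcal I}$, common support interval $J$, score $s_\nu$, and a kernel $K_\nu$ with respect to $P_\nu$ for each $\nu\in\mathcal I$. Suppose $u:J\to[0,\infty)$ satisfies the regularity condition, and let $P_\nu^u$ be the probability measure defined by $$\frac{dP_\nu^u}{dP_\nu}(x)=\frac{u(x)}{\int_J u\,dP_\nu},\qquad x\in J.$$ Then, for every $\nu\in\mathcal I$, $$\partial_\nu\log\int_J u\,dP_\nu=\int_J s_\nu\,dP_\nu^u=\int_J K_\nu\,dP_\nu^u-\int_J K_\nu\,dP_\nu.$$ If $v:J\to[0,\infty)$ also satisfies the regularity condition, and $P_\nu^v$ is defined analogously, then $$\partial_\nu\log\frac{\int_J u\,dP_\nu}{\int_J v\,dP_\nu}=\int_J s_\nu\,dP_\nu^u-\int_J s_\nu\,dP_\nu^v=\int_J K_\nu\,dP_\nu^u-\int_J K_\nu\,dP_\nu^v.$$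
   Context: Setting. $E$ is a totally ordered space and $\mu$ a $\sigma$-finite measure on $E$ (the standard choices are counting measure on an integer interval and Lebesgue measure on an interval of $\mathbb R$). $\mathcal I\subseteq\mathbb R$ is an interval; for each $\nu\in\mathcal I$, $f_\nu$ is a probability density with respect to $\mu$ and $P_\nu(A)=\int_A f_\nu\,d\mu$. The $P_\nu$ have a common support, an interval $J\subseteq E$ (outside $J$, $f_\nu=0$). Standing assumption. $f_\nu(x)>0$ for $x\in J$; $\nu\mapsto\log f_\nu(x)$ is $C^1$ on $\mathcal I$ for every $x\in J$; and for every compact interval $B\subseteq\mathcal I$ there is $m\in L^1(J,\mu)$ with $\sup_{\nu\in B}|\partial_\nu f_\nu(x)|\le m(x)$ for $\mu$-a.e. $x$. Score and kernel. The score is $s_\nu(x)=\partial_\nu\log f_\nu(x)$, $x\in J$. A kernel with respect to $P_\nu$ is any measurable $P_\nu$-integrable function $K_\nu:J\to\mathbb R$ with $s_\nu(x)=K_\nu(x)-\int_J K_\nu\,dP_\nu$ for all $x\in J$. Regularity condition. A measurable function $u:J\to[0,\infty)$ satisfies the regularity condition if, for every compact interval $B\subseteq\mathcal I$, the integral $\int_J u\,dP_\nu$ is finite and positive for every $\nu\in B$, and there is $m\in L^1(J,\mu)$ with $\sup_{\nu\in B}|u(x)\,\partial_\nu f_\nu(x)|\le m(x)$ for $\mu$-a.e. $x\in J$. *)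

theory Defs
  imports "HOL-Probability.Probability"
begin

text \<open>
  The totally ordered space \<open>E\<close> is \<open>space M\<close>, a subset of a linearly ordered type, so that for
  instance \<open>count_space {a..b}\<close> over \<open>int\<close> and \<open>lebesgue_on {a..b}\<close> are both covered.
  Functions on \<open>J\<close> are total functions whose values outside \<open>J\<close> are irrelevant.
\<close>

definition order_interval_of :: "'a::linorder set \<Rightarrow> 'a set \<Rightarrow> bool" where
  "order_interval_of E J \<longleftrightarrow>
     J \<subseteq> E \<and> (\<forall>x\<in>J. \<forall>y\<in>J. \<forall>z\<in>E. x \<le> z \<and> z \<le> y \<longrightarrow> z \<in> J)"

text \<open>
  Derivatives in the parameter are taken within the parameter interval \<open>I\<close>, i.e. they are one-sided
  at an end point belonging to \<open>I\<close>; the family is not constrained at parameters outside \<open>I\<close>.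
\<close>

definition param_deriv :: "real set \<Rightarrow> (real \<Rightarrow> real) \<Rightarrow> real \<Rightarrow> real" where
  "param_deriv I g \<nu> = vector_derivative g (at \<nu> within I)"

definition C1_within :: "real set \<Rightarrow> (real \<Rightarrow> real) \<Rightarrow> bool" where
  "C1_within I g \<longleftrightarrow> g differentiable_on I \<and> continuous_on I (param_deriv I g)"

definition density_family ::
  "'a::linorder measure \<Rightarrow> real set \<Rightarrow> 'a set \<Rightarrow> (real \<Rightarrow> 'a \<Rightarrow> real) \<Rightarrow> bool" where
  "density_family M I J f \<longleftrightarrow>
     sigma_finite_measure M \<and> is_interval I \<and> order_interval_of (space M) J \<and>
     (\<forall>\<nu>\<in>I. f \<nu> \<in> borel_measurable M \<and> (\<forall>x\<in>space M. 0 \<le> f \<nu> x) \<and>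
            (\<integral>\<^sup>+ x. ennreal (f \<nu> x) \<partial>M) = 1 \<and>
            (\<forall>x\<in>space M - J. f \<nu> x = 0))"

definition family_measure :: "'a measure \<Rightarrow> (real \<Rightarrow> 'a \<Rightarrow> real) \<Rightarrow> real \<Rightarrow> 'a measure" where
  "family_measure M f \<nu> = density M (\<lambda>x. ennreal (f \<nu> x))"

text \<open>\<open>sup\<^bsub>\<nu>\<in>B\<^esub> |g \<nu> x| \<le> m x\<close> is written as a bound for every \<open>\<nu> \<in> B\<close>.\<close>

definition locally_dominated ::
  "'a measure \<Rightarrow> real set \<Rightarrow> 'a set \<Rightarrow> (real \<Rightarrow> 'a \<Rightarrow> real) \<Rightarrow> bool" where
  "locally_dominated M I J g \<longleftrightarrow>
     (\<forall>B. compact B \<and> is_interval B \<and> B \<subseteq> I \<longrightarrow>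
        (\<exists>m. set_integrable M J m \<and> (AE x in M. x \<in> J \<longrightarrow> (\<forall>\<nu>\<in>B. \<bar>g \<nu> x\<bar> \<le> m x))))"

definition standing_assumption ::
  "'a measure \<Rightarrow> real set \<Rightarrow> 'a set \<Rightarrow> (real \<Rightarrow> 'a \<Rightarrow> real) \<Rightarrow> bool" where
  "standing_assumption M I J f \<longleftrightarrow>
     (\<forall>\<nu>\<in>I. \<forall>x\<in>J. 0 < f \<nu> x) \<and>
     (\<forall>x\<in>J. C1_within I (\<lambda>\<nu>. ln (f \<nu> x))) \<and>
     locally_dominated M I J (\<lambda>\<nu> x. param_deriv I (\<lambda>t. f t x) \<nu>)"

definition score :: "real set \<Rightarrow> (real \<Rightarrow> 'a \<Rightarrow> real) \<Rightarrow> real \<Rightarrow> 'a \<Rightarrow> real" where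
  "score I f \<nu> x = param_deriv I (\<lambda>t. ln (f t x)) \<nu>"

definition score_kernel ::
  "'a measure \<Rightarrow> real set \<Rightarrow> 'a set \<Rightarrow> (real \<Rightarrow> 'a \<Rightarrow> real) \<Rightarrow> real \<Rightarrow> ('a \<Rightarrow> real) \<Rightarrow> bool" where
  "score_kernel M I J f \<nu> k \<longleftrightarrow>
     k \<in> borel_measurable (restrict_space M J) \<and>
     set_integrable (family_measure M f \<nu>) J k \<and>
     (\<forall>x\<in>J. score I f \<nu> x = k x - (LINT y:J|family_measure M f \<nu>. k y))"

definition regularity_condition ::
  "'a measure \<Rightarrow> real set \<Rightarrow> 'a set \<Rightarrow> (real \<Rightarrow> 'a \<Rightarrow> real) \<Rightarrow> ('a \<Rightarrow> real) \<Rightarrow> bool" where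
  "regularity_condition M I J f u \<longleftrightarrow>
     u \<in> borel_measurable (restrict_space M J) \<and> (\<forall>x\<in>J. 0 \<le> u x) \<and>
     (\<forall>B. compact B \<and> is_interval B \<and> B \<subseteq> I \<longrightarrow>
        (\<forall>\<nu>\<in>B. set_integrable (family_measure M f \<nu>) J u \<and>
                0 < (LINT x:J|family_measure M f \<nu>. u x))) \<and>
     locally_dominated M I J (\<lambda>\<nu> x. u x * param_deriv I (\<lambda>t. f t x) \<nu>)"

definition weighted_measure ::
  "'a measure \<Rightarrow> 'a set \<Rightarrow> (real \<Rightarrow> 'a \<Rightarrow> real) \<Rightarrow> ('a \<Rightarrow> real) \<Rightarrow> real \<Rightarrow> 'a measure" where
  "weighted_measure M J f u \<nu> =
     density (family_measure M f \<nu>)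
       (\<lambda>x. ennreal (indicator J x * (u x / (LINT y:J|family_measure M f \<nu>. u y))))"

lemma prob_space_family_measure:
  assumes "density_family M I J f" and "\<nu> \<in> I"
  shows "prob_space (family_measure M f \<nu>)"
proof (rule prob_spaceI)
  have [measurable]: "f \<nu> \<in> borel_measurable M" using assms by (auto simp: density_family_def)
  have "(\<integral>\<^sup>+ x. ennreal (f \<nu> x) * indicator (space M) x \<partial>M) = (\<integral>\<^sup>+ x. ennreal (f \<nu> x) \<partial>M)"
    by (intro nn_integral_cong) auto
  then show "emeasure (family_measure M f \<nu>) (space (family_measure M f \<nu>)) = 1"
    using assms by (simp add: family_measure_def emeasure_density density_family_def)
qed

lemma prob_space_weighted_measure:
  assumes "regularity_condition M I J f u" and "\<nu> \<in> I"
  shows "prob_space (weighted_measure M J f u \<nu>)"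
proof (rule prob_spaceI)
  let ?P = "family_measure M f \<nu>"
  let ?Z = "LINT y:J|?P. u y"
  have "compact {\<nu>} \<and> is_interval {\<nu>} \<and> {\<nu>} \<subseteq> I" using assms(2) by (auto simp: is_interval_1)
  with assms(1) have int: "set_integrable ?P J u" and Z: "0 < ?Z"
    unfolding regularity_condition_def by blast+
  have nn: "0 \<le> u x" if "x \<in> J" for x
    using assms(1) that by (auto simp: regularity_condition_def)
  have int': "integrable ?P (\<lambda>x. indicator J x * (u x / ?Z))"
    using integrable_mult_left[OF int[unfolded set_integrable_def], of "1 / ?Z"] by simp
  have ge: "0 \<le> indicator J x * (u x / ?Z)" for x
    using nn Z by (auto simp: indicator_def)
  have "(\<integral>\<^sup>+ x. ennreal (indicator J x * (u x / ?Z)) * indicator (space ?P) x \<partial>?P)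
      = (\<integral>\<^sup>+ x. ennreal (indicator J x * (u x / ?Z)) \<partial>?P)"
    by (intro nn_integral_cong) auto
  also have "\<dots> = ennreal (LINT x|?P. indicator J x * (u x / ?Z))"
    using int' ge by (intro nn_integral_eq_integral) auto
  also have "(LINT x|?P. indicator J x * (u x / ?Z)) = (LINT x|?P. indicator J x * u x) / ?Z"
    by simp
  also have "\<dots> = 1" using Z by (simp add: set_lebesgue_integral_def)
  finally show "emeasure (weighted_measure M J f u \<nu>) (space (weighted_measure M J f u \<nu>)) = 1"
    using borel_measurable_integrable[OF int']
    by (simp add: weighted_measure_def emeasure_density)
qed

end

theory Submission imports Defs begin

text \<open>
  Write \<open>Z \<nu> = \<integral>\<^sub>J u f\<^sub>\<nu> d\<mu>\<close>. Since \<open>\<partial>\<^sub>\<nu> f\<^sub>\<nu> = f\<^sub>\<nu> s\<^sub>\<nu>\<close> on \<open>J\<close>, differentiation under the integral sign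
  gives \<open>Z' \<nu> = \<integral>\<^sub>J u f\<^sub>\<nu> s\<^sub>\<nu> d\<mu>\<close>. The reweighted measure has density \<open>u f\<^sub>\<nu> / Z \<nu>\<close> with respect to
  \<open>\<mu>\<close>, so \<open>(ln Z)' \<nu> = Z' \<nu> / Z \<nu>\<close> is exactly the mean of the score under it. A kernel differs from
  the score on \<open>J\<close> by the constant \<open>\<integral>\<^sub>J K\<^sub>\<nu> dP\<^sub>\<nu>\<close>, and a probability measure carried by \<open>J\<close>
  reproduces constants; this turns score means into kernel means. In a log ratio the constants cancel.

  The analytic step is a Leibniz rule relative to a parameter interval
  (\<open>has_real_derivative_integral_dominated\<close>): at a point of \<open>I\<close> the difference quotients of \<open>u f\<^sub>\<nu>\<close>
  are bounded, by the mean value theorem on a compact subinterval, by the dominating function that the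
  regularity condition supplies, and dominated convergence applies. Because an end point of \<open>I\<close> may
  belong to \<open>I\<close>, the compact subinterval has to be a neighbourhood of the point only relative to \<open>I\<close>
  (\<open>compact_interval_neighbourhood_within\<close>).

  Two points of measure theory come for free. The support \<open>J\<close> is the set where a density is positive,
  hence measurable; and the score is measurable because it is a kernel minus a constant.

  One degenerate case needs separate care: if \<open>I\<close> is a single point, every real number is a derivative
  within \<open>I\<close>, and \<open>\<partial>\<^sub>\<nu> f\<^sub>\<nu> = f\<^sub>\<nu> s\<^sub>\<nu>\<close> can fail for the derivatives that the choice operator selects.
  But then the score is one constant, so \<open>u f\<^sub>\<nu> s\<^sub>\<nu>\<close> is still integrable
  (\<open>locally_dominated_weighted_score\<close>), while the claim about derivatives is vacuous.
\<close>

section \<open>Differentiation under the integral sign\<close>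

text \<open>
  The mean value theorem bounds every difference quotient based at \<open>\<nu>\<close> by \<open>m\<close>, so dominated
  convergence lets them pass to the limit inside the integral. Derivatives are taken within \<open>B\<close>,
  which makes the rule usable at the end points of \<open>B\<close>.
\<close>

lemma has_real_derivative_integral_dominated:
  fixes g g' :: "real \<Rightarrow> 'a \<Rightarrow> real"
  assumes B: "is_interval B" "\<nu> \<in> B"
    and int: "\<And>t. t \<in> B \<Longrightarrow> integrable M (g t)"
    and deriv: "AE x in M. \<forall>t\<in>B. ((\<lambda>t. g t x) has_real_derivative g' t x) (at t within B)"
    and m: "integrable M m"
    and dom: "AE x in M. \<forall>t\<in>B. \<bar>g' t x\<bar> \<le> m x"
    and meas: "g' \<nu> \<in> borel_measurable M"
  shows "integrable M (g' \<nu>)"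
    and "((\<lambda>t. LINT x|M. g t x) has_real_derivative (LINT x|M. g' \<nu> x)) (at \<nu> within B)"
proof -
  have "AE x in M. norm (g' \<nu> x) \<le> norm (m x)"
    using dom by eventually_elim (use B in fastforce)
  then show "integrable M (g' \<nu>)"
    using Bochner_Integration.integrable_bound[OF m meas] by blast
  let ?G = "\<lambda>t. LINT x|M. g t x"
  \<comment> \<open>Dominated convergence is a statement about sequences, hence the sequential limit.\<close>
  have "((\<lambda>y. (?G y - ?G \<nu>) / (y - \<nu>)) \<longlongrightarrow> (LINT x|M. g' \<nu> x)) (at \<nu> within B)"
    unfolding tendsto_at_iff_sequentially comp_def
  proof (intro allI impI)
    fix X :: "nat \<Rightarrow> real"
    assume X: "\<forall>i. X i \<in> B - {\<nu>}" and lim: "X \<longlonglongrightarrow> \<nu>"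
    let ?q = "\<lambda>i x. (g (X i) x - g \<nu> x) / (X i - \<nu>)"
    have "AE x in M. (\<lambda>i. ?q i x) \<longlonglongrightarrow> g' \<nu> x"
      using deriv
    proof eventually_elim
      case (elim x)
      then have "((\<lambda>y. (g y x - g \<nu> x) / (y - \<nu>)) \<longlongrightarrow> g' \<nu> x) (at \<nu> within B)"
        using B by (simp add: has_field_derivative_iff)
      then show ?case
        using X lim unfolding tendsto_at_iff_sequentially comp_def by blast
    qed
    moreover have "AE x in M. norm (?q i x) \<le> m x" for i
      using deriv dom
    proof eventually_elim
      case (elim x)
      have "norm (g (X i) x - g \<nu> x) \<le> m x * norm (X i - \<nu>)"
        using elim B X
        by (intro field_differentiable_bound[where S = B and f' = "\<lambda>t. g' t x"])
           (auto simp: is_interval_convex_1)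
      then show ?case using X by (simp add: field_simps)
    qed
    moreover have "?q i \<in> borel_measurable M" for i
      using int[THEN borel_measurable_integrable] X B by auto
    ultimately have "(\<lambda>i. LINT x|M. ?q i x) \<longlonglongrightarrow> (LINT x|M. g' \<nu> x)"
      using meas m by (intro integral_dominated_convergence[where w = m]) auto
    moreover have "(LINT x|M. ?q i x) = (?G (X i) - ?G \<nu>) / (X i - \<nu>)" for i
      using int X B by simp
    ultimately show "(\<lambda>i. (?G (X i) - ?G \<nu>) / (X i - \<nu>)) \<longlonglongrightarrow> (LINT x|M. g' \<nu> x)"
      by (simp only:)
  qed
  then show "(?G has_real_derivative (LINT x|M. g' \<nu> x)) (at \<nu> within B)"
    by (simp add: has_field_derivative_iff)
qed

text \<open>
  Domination holds only on compact subintervals, whereas the derivative is taken within all of \<open>I\<close>. This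
  interval reconciles the two.
\<close>

lemma compact_interval_neighbourhood_within:
  fixes I :: "real set"
  assumes "is_interval I" "\<nu> \<in> I"
  obtains B where "compact B" "is_interval B" "B \<subseteq> I" "\<nu> \<in> B" "at \<nu> within I = at \<nu> within B"
proof -
  obtain a where a: "a \<in> I" "a \<le> \<nu>" "(\<exists>y\<in>I. y < \<nu>) \<longrightarrow> a < \<nu>"
    using assms(2) by (cases "\<exists>y\<in>I. y < \<nu>") force+
  obtain b where b: "b \<in> I" "\<nu> \<le> b" "(\<exists>y\<in>I. \<nu> < y) \<longrightarrow> \<nu> < b"
    using assms(2) by (cases "\<exists>y\<in>I. \<nu> < y") force+
  \<comment> \<open>The window \<open>{l<..<r}\<close> stops at \<open>a\<close> and \<open>b\<close> where \<open>I\<close> continues beyond \<open>\<nu>\<close>; on a side where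
     \<open>\<nu>\<close> is the end of \<open>I\<close> it extends by an arbitrary amount, so that it is open around \<open>\<nu>\<close>.\<close>
  define l where "l = (if a < \<nu> then a else \<nu> - 1)"
  define r where "r = (if \<nu> < b then b else \<nu> + 1)"
  have sub: "{a..b} \<subseteq> I"
    using assms(1) a b unfolding is_interval_1 by (meson atLeastAtMost_iff subsetI)
  have "\<nu> \<in> {l<..<r}" by (auto simp: l_def r_def)
  moreover have "I \<inter> {l<..<r} - {\<nu>} = {a..b} \<inter> {l<..<r} - {\<nu>}"
  proof (rule set_eqI)
    fix y
    have "a \<le> y \<and> y \<le> b" if "y \<in> I" "l < y" "y < r"
      using that a b by (force simp: l_def r_def split: if_splits)
    moreover have "y \<in> I" if "a \<le> y" "y \<le> b"
      using that sub by auto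
    ultimately show "y \<in> I \<inter> {l<..<r} - {\<nu>} \<longleftrightarrow> y \<in> {a..b} \<inter> {l<..<r} - {\<nu>}"
      by auto
  qed
  ultimately have "at \<nu> within I = at \<nu> within {a..b}"
    by (intro at_within_nhd[where S = "{l<..<r}"]) auto
  with sub a b show thesis
    by (intro that[of "{a..b}"]) (auto simp: is_interval_cc)
qed

section \<open>The score and the density\<close>

lemma support_in_sets:
  assumes "density_family M I J f" "standing_assumption M I J f" "\<nu> \<in> I"
  shows "J \<in> sets M"
proof -
  have [measurable]: "f \<nu> \<in> borel_measurable M" and sub: "J \<subseteq> space M"
    and z: "\<forall>x\<in>space M - J. f \<nu> x = 0" and p: "\<forall>x\<in>J. 0 < f \<nu> x"
    using assms by (auto simp: density_family_def standing_assumption_def order_interval_of_def)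
  have "J = {x \<in> space M. 0 < f \<nu> x}" using sub z p
    by (intro set_eqI iffI) (blast, metis DiffI less_irrefl mem_Collect_eq)
  also have "\<dots> \<in> sets M" by measurable
  finally show ?thesis .
qed

text \<open>
  The smoothness assumption concerns \<open>ln f\<close>, so the density is differentiated as \<open>exp (ln f)\<close>.
\<close>

lemma density_has_derivative_score:
  assumes "standing_assumption M I J f" "\<nu> \<in> I" "x \<in> J"
  shows "((\<lambda>t. f t x) has_real_derivative f \<nu> x * score I f \<nu> x) (at \<nu> within I)"
proof -
  have pos: "0 < f t x" if "t \<in> I" for t
    using assms that by (auto simp: standing_assumption_def)
  have "(\<lambda>t. ln (f t x)) differentiable (at \<nu> within I)"
    using assms by (auto simp: standing_assumption_def C1_within_def differentiable_on_def)
  then have "((\<lambda>t. ln (f t x)) has_real_derivative score I f \<nu> x) (at \<nu> within I)"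
    by (simp add: vector_derivative_works score_def param_deriv_def
        has_real_derivative_iff_has_vector_derivative)
  then have "((\<lambda>t. exp (ln (f t x))) has_real_derivative exp (ln (f \<nu> x)) * score I f \<nu> x)
      (at \<nu> within I)"
    by (rule DERIV_chain2[OF DERIV_exp])
  then have "((\<lambda>t. exp (ln (f t x))) has_real_derivative f \<nu> x * score I f \<nu> x) (at \<nu> within I)"
    using pos assms(2) by simp
  then show ?thesis
    by (rule has_field_derivative_transform_within[OF _ zero_less_one assms(2)])
       (use pos in simp)
qed

text \<open>
  The product \<open>f \<nu> x * score I f \<nu> x\<close> is a derivative of the density even when \<open>I\<close> is a single point, but
  only for a nondegenerate interval are derivatives within \<open>I\<close> unique, so that it is the one denoted
  by \<open>param_deriv\<close>.
\<close>

lemma param_deriv_density: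
  assumes "standing_assumption M I J f" "is_interval I" "I \<noteq> {\<nu>}" "\<nu> \<in> I" "x \<in> J"
  shows "param_deriv I (\<lambda>t. f t x) \<nu> = f \<nu> x * score I f \<nu> x"
proof -
  have "\<nu> islimpt I"
    using assms by (intro connected_imp_perfect) (auto simp: is_interval_connected_1)
  then have "at \<nu> within I \<noteq> bot"
    by (simp add: trivial_limit_within)
  moreover have "((\<lambda>t. f t x) has_vector_derivative f \<nu> x * score I f \<nu> x) (at \<nu> within I)"
    using density_has_derivative_score[OF assms(1,4,5)]
    by (simp add: has_real_derivative_iff_has_vector_derivative)
  ultimately show ?thesis
    unfolding param_deriv_def by (rule vector_derivative_within)
qed

text \<open>
  Within a single point every number is a derivative of every function, so the choice in the
  definition of \<open>vector_derivative\<close> ranges over all reals and cannot depend on the function.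
\<close>

lemma score_singleton:
  "score {\<nu>} f \<nu> x = score {\<nu>} f \<nu> y"
proof -
  have "(g has_vector_derivative d) (at \<nu> within {\<nu>})" for g :: "real \<Rightarrow> real" and d
    unfolding has_vector_derivative_def has_derivative_within_singleton_iff
    by (rule bounded_linear_scaleR_left)
  then show ?thesis
    by (simp only: score_def param_deriv_def vector_derivative_def)
qed

section \<open>Integrals against the family and its reweightings\<close>

lemma family_measure_set_integral:
  assumes "density_family M I J f" "standing_assumption M I J f" "\<nu> \<in> I"
    and "h \<in> borel_measurable (restrict_space M J)"
  shows "set_integrable (family_measure M f \<nu>) J h \<longleftrightarrow> set_integrable M J (\<lambda>x. f \<nu> x * h x)"
    and "(LINT x:J|family_measure M f \<nu>. h x) = (LINT x:J|M. f \<nu> x * h x)"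
proof -
  have [measurable]: "J \<in> sets M" using support_in_sets assms(1-3) .
  have f: "f \<nu> \<in> borel_measurable M" and nn: "AE x in M. 0 \<le> f \<nu> x"
    using assms by (auto simp: density_family_def)
  have h: "(\<lambda>x. indicator J x *\<^sub>R h x) \<in> borel_measurable M"
    using assms(4) by (simp add: borel_measurable_restrict_space_iff)
  show "set_integrable (family_measure M f \<nu>) J h \<longleftrightarrow> set_integrable M J (\<lambda>x. f \<nu> x * h x)"
    unfolding set_integrable_def family_measure_def
    unfolding integrable_density[OF h f nn] by (simp add: mult_ac)
  show "(LINT x:J|family_measure M f \<nu>. h x) = (LINT x:J|M. f \<nu> x * h x)"
    unfolding set_lebesgue_integral_def family_measure_def
    unfolding integral_density[OF h f nn] by (simp add: mult_ac)
qed

lemma regularity_conditionD: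
  assumes "regularity_condition M I J f u" "\<nu> \<in> I"
  shows "u \<in> borel_measurable (restrict_space M J)" "\<And>x. x \<in> J \<Longrightarrow> 0 \<le> u x"
    and "set_integrable (family_measure M f \<nu>) J u"
    and "0 < (LINT x:J|family_measure M f \<nu>. u x)"
proof -
  have "compact {\<nu>} \<and> is_interval {\<nu>} \<and> {\<nu>} \<subseteq> I" using assms(2) by (auto simp: is_interval_1)
  then show "set_integrable (family_measure M f \<nu>) J u"
    and "0 < (LINT x:J|family_measure M f \<nu>. u x)"
    using assms(1) unfolding regularity_condition_def by blast+
qed (use assms in \<open>auto simp: regularity_condition_def\<close>)

lemma weighted_measure_set_integral:
  assumes "density_family M I J f" "standing_assumption M I J f"
    and "regularity_condition M I J f u" "\<nu> \<in> I"
    and "h \<in> borel_measurable (restrict_space M J)"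
  shows "set_integrable (weighted_measure M J f u \<nu>) J h
      \<longleftrightarrow> set_integrable M J (\<lambda>x. u x * (f \<nu> x * h x))"
    and "(LINT x:J|weighted_measure M J f u \<nu>. h x)
      = (LINT x:J|M. u x * (f \<nu> x * h x)) / (LINT x:J|family_measure M f \<nu>. u x)"
proof -
  let ?P = "family_measure M f \<nu>"
  define Z where "Z = (LINT x:J|?P. u x)"
  note reg = regularity_conditionD[OF assms(3,4)]
  have Z: "0 < Z" using reg(4) by (simp add: Z_def)
  have sets: "sets ?P = sets M" by (simp add: family_measure_def)
  have J: "J \<in> sets M" using support_in_sets assms(1,2,4) .
  have h: "(\<lambda>x. indicator J x *\<^sub>R h x) \<in> borel_measurable ?P"
    using assms(5) J by (simp add: borel_measurable_restrict_space_iff measurable_cong_sets[OF sets])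
  have "(\<lambda>x. indicator J x *\<^sub>R u x) \<in> borel_measurable ?P"
    using reg(1) J by (simp add: borel_measurable_restrict_space_iff measurable_cong_sets[OF sets])
  from borel_measurable_divide[OF this borel_measurable_const[of Z]]
  have w: "(\<lambda>x. indicator J x * (u x / Z)) \<in> borel_measurable ?P" by simp
  have nn: "AE x in ?P. 0 \<le> indicator J x * (u x / Z)"
    using reg(2) Z by (auto simp: indicator_def)
  have uh: "(\<lambda>x. u x * h x) \<in> borel_measurable (restrict_space M J)"
    using reg(1) assms(5) by measurable
  have W: "weighted_measure M J f u \<nu> = density ?P (\<lambda>x. ennreal (indicator J x * (u x / Z)))"
    by (simp add: weighted_measure_def Z_def)
  have eq: "(indicator J x * (u x / Z)) *\<^sub>R indicator J x *\<^sub>R h x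
      = inverse Z * (indicator J x *\<^sub>R (u x * h x))" for x
    by (simp add: indicator_def divide_inverse)
  have "set_integrable (weighted_measure M J f u \<nu>) J h \<longleftrightarrow> set_integrable ?P J (\<lambda>x. u x * h x)"
    unfolding set_integrable_def W integrable_density[OF h w nn] eq integrable_mult_left_iff
    using Z by simp
  then show "set_integrable (weighted_measure M J f u \<nu>) J h
      \<longleftrightarrow> set_integrable M J (\<lambda>x. u x * (f \<nu> x * h x))"
    using family_measure_set_integral(1)[OF assms(1,2,4) uh] by (simp add: mult_ac)
  have "(LINT x:J|weighted_measure M J f u \<nu>. h x) = (LINT x:J|?P. u x * h x) / Z"
    unfolding set_lebesgue_integral_def W integral_density[OF h w nn] eq
    by (simp only: integral_mult_right_zero divide_inverse_commute)
  then show "(LINT x:J|weighted_measure M J f u \<nu>. h x)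
      = (LINT x:J|M. u x * (f \<nu> x * h x)) / (LINT x:J|family_measure M f \<nu>. u x)"
    using family_measure_set_integral(2)[OF assms(1,2,4) uh] by (simp add: mult_ac Z_def)
qed

text \<open>
  The normalisation by \<open>\<integral>\<^sub>J u dP\<^sub>\<nu>\<close> gives \<open>J\<close> total mass one.
\<close>

lemma weighted_measure_constant:
  assumes "density_family M I J f" "standing_assumption M I J f"
    and "regularity_condition M I J f u" "\<nu> \<in> I"
  shows "set_integrable (weighted_measure M J f u \<nu>) J (\<lambda>x. c :: real)"
    and "(LINT x:J|weighted_measure M J f u \<nu>. c) = c"
proof -
  note reg = regularity_conditionD[OF assms(3,4)]
  note fam = family_measure_set_integral[OF assms(1,2,4) reg(1)]
  have "u x * (f \<nu> x * c) = c * (f \<nu> x * u x)" for x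
    by (simp only: mult.assoc mult.left_commute mult.commute)
  note wgt = weighted_measure_set_integral[OF assms borel_measurable_const[of c], unfolded this]
  have "set_integrable M J (\<lambda>x. f \<nu> x * u x)" using reg(3) fam(1) by simp
  then have "set_integrable M J (\<lambda>x. c * (f \<nu> x * u x))" by (rule set_integrable_mult_right)
  then show "set_integrable (weighted_measure M J f u \<nu>) J (\<lambda>x. c)"
    by (simp only: wgt(1))
  show "(LINT x:J|weighted_measure M J f u \<nu>. c) = c"
    using reg(4) by (simp add: wgt(2) fam(2))
qed

section \<open>The derivative of the log normaliser\<close>

text \<open>
  For a nondegenerate \<open>I\<close> the function is \<open>u\<close> times the derivative of the density, and the
  domination is the one in the regularity condition. For a single point that identification may fail;
  the score is then constant, and integrability of \<open>u\<close> against the family replaces it.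
\<close>

lemma locally_dominated_weighted_score:
  assumes "density_family M I J f" "standing_assumption M I J f"
    and "regularity_condition M I J f u"
  shows "locally_dominated M I J (\<lambda>\<nu> x. u x * (f \<nu> x * score I f \<nu> x))"
proof (cases "\<exists>\<nu>. I = {\<nu>}")
  case True
  then obtain \<nu> where I: "I = {\<nu>}" by blast
  note reg = regularity_conditionD[OF assms(3), of \<nu>]
  define c where "c = score I f \<nu> undefined"
  have c: "score I f \<nu> x = c" for x
    unfolding c_def I by (rule score_singleton)
  have "set_integrable M J (\<lambda>x. f \<nu> x * u x)"
    using reg family_measure_set_integral(1)[OF assms(1,2)] by (simp add: I)
  then have "set_integrable M J (\<lambda>x. \<bar>f \<nu> x * u x * c\<bar>)"
    by (intro set_integrable_abs set_integrable_mult_left) auto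
  then show ?thesis
    unfolding locally_dominated_def
  proof (intro allI impI exI conjI)
    fix B assume "compact B \<and> is_interval B \<and> B \<subseteq> I"
    then have "\<bar>u x * (f t x * score I f t x)\<bar> \<le> \<bar>f \<nu> x * u x * c\<bar>" if "t \<in> B" for t x
      using that c by (auto simp: I abs_mult)
    then show "AE x in M. x \<in> J \<longrightarrow>
        (\<forall>t\<in>B. \<bar>u x * (f t x * score I f t x)\<bar> \<le> \<bar>f \<nu> x * u x * c\<bar>)"
      by blast
  qed
next
  case False
  have eq: "param_deriv I (\<lambda>t. f t x) \<nu> = f \<nu> x * score I f \<nu> x" if "\<nu> \<in> I" "x \<in> J" for \<nu> x
    using assms False that by (intro param_deriv_density) (auto simp: density_family_def)
  show ?thesis
    unfolding locally_dominated_def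
  proof (intro allI impI)
    fix B assume B: "compact B \<and> is_interval B \<and> B \<subseteq> I"
    then obtain m where m: "set_integrable M J m"
      and dom: "AE x in M. x \<in> J \<longrightarrow> (\<forall>\<nu>\<in>B. \<bar>u x * param_deriv I (\<lambda>t. f t x) \<nu>\<bar> \<le> m x)"
      using assms(3) unfolding regularity_condition_def locally_dominated_def by blast
    from dom have "AE x in M. x \<in> J \<longrightarrow> (\<forall>\<nu>\<in>B. \<bar>u x * (f \<nu> x * score I f \<nu> x)\<bar> \<le> m x)"
      by eventually_elim (use B eq in \<open>metis subsetD\<close>)
    with m show "\<exists>m. set_integrable M J m \<and>
        (AE x in M. x \<in> J \<longrightarrow> (\<forall>\<nu>\<in>B. \<bar>u x * (f \<nu> x * score I f \<nu> x)\<bar> \<le> m x))"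
      by blast
  qed
qed

text \<open>
  The Leibniz rule for \<open>u f\<^sub>\<nu>\<close>. Measurability of the score is a hypothesis because it will come from a
  kernel.
\<close>

lemma normaliser_has_derivative:
  assumes "density_family M I J f" "standing_assumption M I J f"
    and "regularity_condition M I J f u" "\<nu> \<in> I"
    and s: "score I f \<nu> \<in> borel_measurable (restrict_space M J)"
  shows "set_integrable M J (\<lambda>x. u x * (f \<nu> x * score I f \<nu> x))"
    and "((\<lambda>t. LINT x:J|family_measure M f t. u x) has_real_derivative
           (LINT x:J|M. u x * (f \<nu> x * score I f \<nu> x))) (at \<nu> within I)"
proof -
  note reg = regularity_conditionD[OF assms(3)]
  note fam = family_measure_set_integral[OF assms(1,2) _ reg(1)]
  have J: "J \<in> sets M" using support_in_sets assms(1,2,4) .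
  have "is_interval I" using assms(1) by (simp add: density_family_def)
  then obtain B where B: "compact B" "is_interval B" "B \<subseteq> I" "\<nu> \<in> B"
    and at_eq: "at \<nu> within I = at \<nu> within B"
    using assms(4) by (rule compact_interval_neighbourhood_within)
  obtain m where m: "set_integrable M J m"
    and dom: "AE x in M. x \<in> J \<longrightarrow> (\<forall>\<nu>\<in>B. \<bar>u x * (f \<nu> x * score I f \<nu> x)\<bar> \<le> m x)"
    using locally_dominated_weighted_score[OF assms(1-3)] B unfolding locally_dominated_def by blast
  let ?g = "\<lambda>t x. indicator J x *\<^sub>R (f t x * u x)"
  let ?g' = "\<lambda>t x. indicator J x *\<^sub>R (u x * (f t x * score I f t x))"
  have int: "integrable M (?g t)" if "t \<in> B" for t
    using reg(3)[of t] fam(1)[of t] that B by (auto simp: set_integrable_def)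
  have deriv: "((\<lambda>t. ?g t x) has_real_derivative ?g' t x) (at t within B)" if "t \<in> B" for t x
  proof (cases "x \<in> J")
    case True
    have "((\<lambda>t. f t x) has_real_derivative f t x * score I f t x) (at t within B)"
      using density_has_derivative_score[OF assms(2) _ True, of t] that B
      by (blast intro: DERIV_subset)
    from DERIV_cmult_right[OF this, of "u x"] True show ?thesis by (simp add: mult_ac)
  qed simp
  have "f \<nu> \<in> borel_measurable M" using assms by (auto simp: density_family_def)
  then have "f \<nu> \<in> borel_measurable (restrict_space M J)" by (rule measurable_restrict_space1)
  with s reg(1)[OF assms(4)]
  have "(\<lambda>x. u x * (f \<nu> x * score I f \<nu> x)) \<in> borel_measurable (restrict_space M J)" by measurable
  then have meas: "?g' \<nu> \<in> borel_measurable M"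
    using J by (simp add: borel_measurable_restrict_space_iff)
  have dom': "AE x in M. \<forall>t\<in>B. \<bar>?g' t x\<bar> \<le> indicator J x *\<^sub>R m x"
    using dom by eventually_elim (auto simp: indicator_def)
  note leibniz = has_real_derivative_integral_dominated[OF B(2,4) int _ m[unfolded set_integrable_def] dom' meas]
  show "set_integrable M J (\<lambda>x. u x * (f \<nu> x * score I f \<nu> x))"
    unfolding set_integrable_def using deriv by (intro leibniz(1)) auto
  have "((\<lambda>t. LINT x|M. ?g t x) has_real_derivative (LINT x|M. ?g' \<nu> x)) (at \<nu> within I)"
    unfolding at_eq using deriv by (intro leibniz(2)) auto
  then have "((\<lambda>t. LINT x|M. ?g t x) has_real_derivative
      (LINT x:J|M. u x * (f \<nu> x * score I f \<nu> x))) (at \<nu> within I)"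
    by (simp add: set_lebesgue_integral_def)
  then show "((\<lambda>t. LINT x:J|family_measure M f t. u x) has_real_derivative
           (LINT x:J|M. u x * (f \<nu> x * score I f \<nu> x))) (at \<nu> within I)"
    by (rule has_field_derivative_transform_within[OF _ zero_less_one assms(4)])
       (use fam(2) in \<open>simp add: set_lebesgue_integral_def\<close>)
qed

text \<open>
  The logarithmic derivative divides the integral of \<open>u f\<^sub>\<nu> s\<^sub>\<nu>\<close> by the normaliser, which is the same
  division as in the density of the weighted measure.
\<close>

lemma log_normaliser_derivative:
  assumes "density_family M I J f" "standing_assumption M I J f"
    and "score_kernel M I J f \<nu> k"
    and "regularity_condition M I J f u" "\<nu> \<in> I"
  defines "W \<equiv> weighted_measure M J f u \<nu>"
  shows "set_integrable W J (score I f \<nu>)"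
    and "set_integrable W J k"
    and "((\<lambda>t. ln (LINT x:J|family_measure M f t. u x)) has_real_derivative
           (LINT x:J|W. score I f \<nu> x)) (at \<nu> within I)"
    and "(LINT x:J|W. score I f \<nu> x) = (LINT x:J|W. k x) - (LINT x:J|family_measure M f \<nu>. k x)"
proof -
  define c where "c = (LINT x:J|family_measure M f \<nu>. k x)"
  have k: "k \<in> borel_measurable (restrict_space M J)"
    and sk: "\<And>x. x \<in> J \<Longrightarrow> score I f \<nu> x = k x - c"
    using assms(3) by (auto simp: score_kernel_def c_def)
  have J: "J \<in> sets M" using support_in_sets assms(1,2,5) .
  have s: "score I f \<nu> \<in> borel_measurable (restrict_space M J)"
    by (subst measurable_cong[where g = "\<lambda>x. k x - c"])
       (use k sk in \<open>auto simp: space_restrict_space\<close>)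
  note wgt = weighted_measure_set_integral[OF assms(1,2,4,5) s, folded W_def]
  note ws = normaliser_has_derivative[OF assms(1,2,4,5) s]
  note const = weighted_measure_constant[OF assms(1,2,4,5), folded W_def]
  show int: "set_integrable W J (score I f \<nu>)" using wgt(1) ws(1) by simp
  have JW: "J \<in> sets W"
    using J by (simp add: W_def weighted_measure_def family_measure_def)
  have "set_integrable W J (\<lambda>x. score I f \<nu> x + c)"
    using int const(1) by (rule set_integral_add(1))
  then show intk: "set_integrable W J k"
    by (subst set_integrable_cong[OF refl refl, of _ _ "\<lambda>x. score I f \<nu> x + c"]) (auto simp: sk)
  have "(LINT x:J|W. score I f \<nu> x) = (LINT x:J|W. k x - c)"
    using JW sk by (intro set_lebesgue_integral_cong) auto
  also have "\<dots> = (LINT x:J|W. k x) - c"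
    using intk const by (simp add: set_integral_diff(2))
  finally show "(LINT x:J|W. score I f \<nu> x)
      = (LINT x:J|W. k x) - (LINT x:J|family_measure M f \<nu>. k x)"
    by (simp add: c_def)
  show "((\<lambda>t. ln (LINT x:J|family_measure M f t. u x)) has_real_derivative
           (LINT x:J|W. score I f \<nu> x)) (at \<nu> within I)"
    using DERIV_chain2[OF DERIV_ln_divide ws(2)] regularity_conditionD(4)[OF assms(4,5)]
    by (simp add: wgt(2))
qed

theorem proposition3p3:
  fixes M :: "'a::linorder measure" and I :: "real set" and J :: "'a set"
    and f :: "real \<Rightarrow> 'a \<Rightarrow> real" and K :: "real \<Rightarrow> 'a \<Rightarrow> real" and u :: "'a \<Rightarrow> real"
  assumes "density_family M I J f"
    and "standing_assumption M I J f"
    and "\<forall>\<nu>\<in>I. score_kernel M I J f \<nu> (K \<nu>)"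
    and "regularity_condition M I J f u"
  shows "(\<forall>\<nu>\<in>I.
            set_integrable (weighted_measure M J f u \<nu>) J (score I f \<nu>) \<and>
            set_integrable (weighted_measure M J f u \<nu>) J (K \<nu>) \<and>
            ((\<lambda>t. ln (LINT x:J|family_measure M f t. u x)) has_real_derivative
               (LINT x:J|weighted_measure M J f u \<nu>. score I f \<nu> x)) (at \<nu> within I) \<and>
            (LINT x:J|weighted_measure M J f u \<nu>. score I f \<nu> x)
              = (LINT x:J|weighted_measure M J f u \<nu>. K \<nu> x)
                - (LINT x:J|family_measure M f \<nu>. K \<nu> x)) \<and>
         (\<forall>v :: 'a \<Rightarrow> real. regularity_condition M I J f v \<longrightarrow>
          (\<forall>\<nu>\<in>I.
            ((\<lambda>t. ln ((LINT x:J|family_measure M f t. u x) / (LINT x:J|family_measure M f t. v x)))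
               has_real_derivative
               ((LINT x:J|weighted_measure M J f u \<nu>. score I f \<nu> x)
                 - (LINT x:J|weighted_measure M J f v \<nu>. score I f \<nu> x))) (at \<nu> within I) \<and>
            (LINT x:J|weighted_measure M J f u \<nu>. score I f \<nu> x)
                - (LINT x:J|weighted_measure M J f v \<nu>. score I f \<nu> x)
              = (LINT x:J|weighted_measure M J f u \<nu>. K \<nu> x)
                - (LINT x:J|weighted_measure M J f v \<nu>. K \<nu> x)))"
proof (intro conjI ballI allI impI)
  fix \<nu> assume \<nu>: "\<nu> \<in> I"
  note L = log_normaliser_derivative[OF assms(1,2) bspec[OF assms(3) \<nu>] _ \<nu>]
  note Lu = L[OF assms(4)]
  show "set_integrable (weighted_measure M J f u \<nu>) J (score I f \<nu>)"
    and "set_integrable (weighted_measure M J f u \<nu>) J (K \<nu>)"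
    and "((\<lambda>t. ln (LINT x:J|family_measure M f t. u x)) has_real_derivative
            (LINT x:J|weighted_measure M J f u \<nu>. score I f \<nu> x)) (at \<nu> within I)"
    and "(LINT x:J|weighted_measure M J f u \<nu>. score I f \<nu> x)
           = (LINT x:J|weighted_measure M J f u \<nu>. K \<nu> x)
             - (LINT x:J|family_measure M f \<nu>. K \<nu> x)"
    by (fact Lu)+
  fix v :: "'a \<Rightarrow> real" assume v: "regularity_condition M I J f v"
  note Lv = L[OF v]
  show "((\<lambda>t. ln ((LINT x:J|family_measure M f t. u x) / (LINT x:J|family_measure M f t. v x)))
      has_real_derivative
      ((LINT x:J|weighted_measure M J f u \<nu>. score I f \<nu> x)
        - (LINT x:J|weighted_measure M J f v \<nu>. score I f \<nu> x))) (at \<nu> within I)"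
    by (rule has_field_derivative_transform_within[OF DERIV_diff[OF Lu(3) Lv(3)] zero_less_one \<nu>])
       (use regularity_conditionD(4)[OF assms(4)] regularity_conditionD(4)[OF v]
        in \<open>simp add: ln_divide_pos\<close>)
  show "(LINT x:J|weighted_measure M J f u \<nu>. score I f \<nu> x)
      - (LINT x:J|weighted_measure M J f v \<nu>. score I f \<nu> x)
    = (LINT x:J|weighted_measure M J f u \<nu>. K \<nu> x)
      - (LINT x:J|weighted_measure M J f v \<nu>. K \<nu> x)"
    using Lu(4) Lv(4) by simp
qed

end
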